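(* The set of zeros of $f$ coincides with $\{z(\sigma)\}_{\sigma\in\Sigma}$, where $$z(\sigma)=-b\prod_{n=1}^{\infty}\frac{a}{Q\bigl(P_{\sigma_n}^{-1}\circ\cdots\circ P_{\sigma_1}^{-1}(0)\bigr)} .$$ Each zero is counted according to its multiplicity; that is, the multiplicity of $z_0$ as a zero of $f$ equals $\#\{\sigma\in\Sigma:\ z(\sigma)=z_0\}$.
   Context: Let $P$ be a complex polynomial of degree $d\ge 2$ and let $b\in\mathbb{C}$, $b\ne 0$, be a repelling fixed point of $P$: $P(b)=b$ and $|a|>1$, where $a:=P'(b)$. Let $f$ be the entire solution of $f(az)=P(f(z))$ ($z\in\mathbb{C}$) with $f(0)=b$, $f'(0)=1$; equivalently $f(z)=\lim_{n\to\infty}P^{\circ n}(b+a^{-n}z)$, uniformly on compact sets. Branches of $P^{-1}$: fix functions $P_0^{-1},\dots,P_{d-1}^{-1}:\mathbb{C}\to\mathbb{C}$ such that for every $w\in\mathbb{C}$ the list $P_0^{-1}(w),\dots,P_{d-1}^{-1}(w)$ is the complete list of solutions $z$ of $P(z)=w$, counted with multiplicity. The principal branch $P_0^{-1}$ satisfies $P_0^{-1}(b)=b$ and is analytic in some open neighbourhood of $b$; otherwise the numbering of the branches is arbitrary and no continuity is required. Standing assumption (Hypothesis 1): for every $w\in\mathbb{C}$, the $n$-fold iterate $(P_0^{-1})^{\circ n}(w)\to b$ as $n\to\infty$. $Q$ is the polynomial $Q(z):=\frac{P(z)-b}{z-b}$ (so $Q(b)=a$). With $\mathbb{N}=\{1,2,\dots\}$,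 $$\Sigma=\{\sigma:\mathbb{N}\to\{0,\dots,d-1\}:\ \lim_{n\to\infty}\sigma_n=0\},$$ i.e. sequences which are eventually $0$. Infinite products over $n$ are limits of partial products. *)

theory Defs
  imports "HOL-Complex_Analysis.Complex_Analysis"
begin

text \<open>The branches of the inverse of \<open>P\<close> are given as a family \<open>B :: nat \<Rightarrow> complex \<Rightarrow> complex\<close>,
  of which only the members \<open>B i\<close> with \<open>i < degree P\<close> are relevant.  The multiset \<open>proots\<close>
  counts roots with multiplicity.\<close>

definition inverse_branches :: "complex poly \<Rightarrow> (nat \<Rightarrow> complex \<Rightarrow> complex) \<Rightarrow> bool" where
  "inverse_branches P B \<longleftrightarrow>
     (\<forall>w. mset (map (\<lambda>i. B i w) [0..<degree P]) = proots (P - [:w:]))"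

definition principal_branch :: "complex \<Rightarrow> (complex \<Rightarrow> complex) \<Rightarrow> bool" where
  "principal_branch b g \<longleftrightarrow> g b = b \<and> (\<exists>U. open U \<and> b \<in> U \<and> g analytic_on U)"

text \<open>The division is exact when \<open>poly P b = b\<close>.\<close>

definition Q_poly :: "complex poly \<Rightarrow> complex \<Rightarrow> complex poly" where
  "Q_poly P b = (P - [:b:]) div [:-b, 1:]"

text \<open>Sequences are indexed by the positive integers.  The extensional function space
  pins down the irrelevant value at \<open>0\<close>, so that sequences can be counted.\<close>

definition Sigma_seqs :: "nat \<Rightarrow> (nat \<Rightarrow> nat) set" where
  "Sigma_seqs d = {\<sigma> \<in> {1..} \<rightarrow>\<^sub>E {..<d}. \<sigma> \<longlonglongrightarrow> 0}"

text \<open>\<open>branch_comp B \<sigma> n = B (\<sigma> n) \<circ> \<dots> \<circ> B (\<sigma> 1)\<close>\<close>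

primrec branch_comp ::
  "(nat \<Rightarrow> complex \<Rightarrow> complex) \<Rightarrow> (nat \<Rightarrow> nat) \<Rightarrow> nat \<Rightarrow> complex \<Rightarrow> complex" where
  "branch_comp B \<sigma> 0 = id"
| "branch_comp B \<sigma> (Suc n) = B (\<sigma> (Suc n)) \<circ> branch_comp B \<sigma> n"

definition partial_product ::
  "complex poly \<Rightarrow> complex \<Rightarrow> (nat \<Rightarrow> complex \<Rightarrow> complex) \<Rightarrow> (nat \<Rightarrow> nat) \<Rightarrow> nat \<Rightarrow> complex" where
  "partial_product P b B \<sigma> N =
     (\<Prod>n=1..N. poly (pderiv P) b / poly (Q_poly P b) (branch_comp B \<sigma> n 0))"

definition z_of ::
  "complex poly \<Rightarrow> complex \<Rightarrow> (nat \<Rightarrow> complex \<Rightarrow> complex) \<Rightarrow> (nat \<Rightarrow> nat) \<Rightarrow> complex" where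
  "z_of P b B \<sigma> = - b * lim (partial_product P b B \<sigma>)"

end

theory Submission
  imports Defs
begin

text \<open>Put \<open>w\<^sub>0 = 0\<close> and \<open>w\<^sub>n = B (\<sigma> n) w\<^sub>n\<^sub>-\<^sub>1\<close>.  Since \<open>Q(w\<^sub>n) = (w\<^sub>n\<^sub>-\<^sub>1 - b) / (w\<^sub>n - b)\<close>, the
  product telescopes: \<open>-b\<close> times the \<open>N\<close>-th partial product is \<open>a\<^sup>N (w\<^sub>N - b)\<close>.  As \<open>w\<^sub>n\<close> tends to \<open>b\<close>
  and \<open>f\<close> is injective near \<open>0\<close>, the backward orbit lifts: \<open>w\<^sub>n = f(z\<^sub>0 / a\<^sup>n)\<close> for all \<open>n\<close>, for a
  unique \<open>z\<^sub>0\<close>, and \<open>z(\<sigma>) = z\<^sub>0\<close> because \<open>f'(0) = 1\<close>.  Hence \<open>z(\<sigma>) = z\<^sub>0\<close> means exactly that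
  each \<open>\<sigma> n\<close> lies in the set \<open>S\<^sub>n\<close> of those \<open>i\<close> with \<open>B i (f(z\<^sub>0 / a\<^sup>n\<^sup>-\<^sup>1)) = f(z\<^sub>0 / a\<^sup>n)\<close>.  Finally
  \<open>S\<^sub>n = {0}\<close> for large \<open>n\<close>, and the number of elements of \<open>S\<^sub>n\<close> is the multiplicity of \<open>f(z\<^sub>0 / a\<^sup>n)\<close>
  as a solution of \<open>P = f(z\<^sub>0 / a\<^sup>n\<^sup>-\<^sup>1)\<close>, so the product of these numbers is, by the chain
  \<open>f(z) = P(f(z / a))\<close>, the multiplicity of the zero \<open>z\<^sub>0\<close>.\<close>

section \<open>Local multiplicities of holomorphic functions\<close>

definition has_multiplicity :: "(complex \<Rightarrow> complex) \<Rightarrow> complex \<Rightarrow> nat \<Rightarrow> bool" where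
  "has_multiplicity f z m \<longleftrightarrow>
     (\<exists>S h. open S \<and> z \<in> S \<and> h holomorphic_on S \<and> h z \<noteq> 0 \<and>
            (\<forall>w\<in>S. f w - f z = h w * (w - z) ^ m))"

lemma zorder_has_multiplicity:
  assumes "has_multiplicity f z m" "f z = 0"
  shows "zorder f z = int m"
proof -
  obtain S h where "open S" "z \<in> S" "h holomorphic_on S" "h z \<noteq> 0"
    "\<And>w. w \<in> S \<Longrightarrow> f w = h w * (w - z) ^ m"
    using assms unfolding has_multiplicity_def by auto
  then show ?thesis
    by (intro zorder_eqI[of S z h]) auto
qed

lemma has_multiplicity_1:
  assumes "f holomorphic_on S" "open S" "z \<in> S" "deriv f z \<noteq> 0"
  shows "has_multiplicity f z 1"
proof -
  obtain h r where "0 < r" "h holomorphic_on ball z r"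
    and "\<And>w. w \<in> ball z r \<Longrightarrow> f w - f z = (w - z) ^ 1 * h w"
    and "\<And>w. w \<in> ball z r \<Longrightarrow> h w \<noteq> 0"
    by (rule holomorphic_factor_order_of_zero[OF assms(1-3), of 1]) (use assms(4) in auto)
  then show ?thesis
    unfolding has_multiplicity_def
    by (intro exI[of _ "ball z r"] exI[of _ h]) (auto simp: mult.commute)
qed

lemma has_multiplicity_divide:
  assumes "has_multiplicity f (z / a) m" "a \<noteq> 0"
  shows "has_multiplicity (\<lambda>x. f (x / a)) z m"
proof -
  obtain S h where S: "open S" "z / a \<in> S" "h holomorphic_on S" "h (z / a) \<noteq> 0"
    and eq: "\<And>w. w \<in> S \<Longrightarrow> f w - f (z / a) = h w * (w - z / a) ^ m"
    using assms unfolding has_multiplicity_def by auto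
  let ?T = "(\<lambda>x. x / a) -` S"
  let ?h = "\<lambda>x. h (x / a) * (1 / a) ^ m"
  have "open ?T"
    using S(1) by (intro open_vimage continuous_intros) (use assms in auto)
  moreover have "(h \<circ> (\<lambda>x. x / a)) holomorphic_on ?T"
    by (rule holomorphic_on_compose_gen[OF _ S(3)])
      (use assms in \<open>auto intro!: holomorphic_intros\<close>)
  then have "?h holomorphic_on ?T"
    by (auto intro!: holomorphic_intros simp: o_def)
  moreover have "f (w / a) - f (z / a) = ?h w * (w - z) ^ m" if "w \<in> ?T" for w
  proof -
    have "(w / a - z / a) ^ m = (1 / a) ^ m * (w - z) ^ m"
      by (simp add: diff_divide_distrib[symmetric] power_divide)
    with eq[of "w / a"] that show ?thesis by simp
  qed
  ultimately show ?thesis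
    unfolding has_multiplicity_def
    using S assms(2) by (intro exI[of _ ?T] exI[of _ ?h]) auto
qed

text \<open>Writing \<open>p - poly p (f z)\<close> as \<open>(x - f z)^k\<close> times a cofactor
  not vanishing at \<open>f z\<close> and substituting the factorisation of \<open>f - f z\<close>
  multiplies the exponents. Multiplicity is measured relative to the value \<open>f z\<close>
  because the points \<open>z / a^n\<close> met later need not be zeros of \<open>f\<close>.\<close>

lemma has_multiplicity_poly:
  assumes "has_multiplicity f z m" "f holomorphic_on UNIV"
    and nz: "p - [:poly p (f z):] \<noteq> 0"
  shows "has_multiplicity (\<lambda>x. poly p (f x)) z (order (f z) (p - [:poly p (f z):]) * m)"
proof -
  define k where "k = order (f z) (p - [:poly p (f z):])"
  obtain S h where S: "open S" "z \<in> S" "h holomorphic_on S" "h z \<noteq> 0"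
    and eq: "\<And>w. w \<in> S \<Longrightarrow> f w - f z = h w * (w - z) ^ m"
    using assms unfolding has_multiplicity_def by auto
  obtain q where q: "p - [:poly p (f z):] = [:- f z, 1:] ^ k * q" "\<not> [:- f z, 1:] dvd q"
    using order_decomp[OF nz] unfolding k_def by blast
  have pq: "poly p x - poly p (f z) = (x - f z) ^ k * poly q x" for x
    using arg_cong[OF q(1), of "\<lambda>r. poly r x"] by simp
  let ?h = "\<lambda>x. h x ^ k * poly q (f x)"
  have "poly q (f z) \<noteq> 0"
    using q(2) by (simp add: poly_eq_0_iff_dvd)
  moreover have "(\<lambda>x. poly q (f x)) holomorphic_on S"
    by (rule holomorphic_on_subset[of _ UNIV]) (use assms(2) in \<open>auto intro!: holomorphic_intros\<close>)
  then have "?h holomorphic_on S"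
    by (intro holomorphic_on_mult holomorphic_on_power S(3))
  moreover have "poly p (f w) - poly p (f z) = ?h w * (w - z) ^ (k * m)" if "w \<in> S" for w
    using eq[OF that] pq[of "f w"] by (simp add: power_mult_distrib power_mult[symmetric] mult.commute)
  ultimately show ?thesis
    unfolding has_multiplicity_def k_def[symmetric]
    using S by (intro exI[of _ S] exI[of _ ?h]) auto
qed

section \<open>The quotient \<open>Q\<close> and inverse branches as root counts\<close>

lemma Q_poly_mult:
  assumes "poly P b = b"
  shows "poly (Q_poly P b) x * (x - b) = poly P x - b"
proof -
  have "[:- b, 1:] dvd P - [:b:]"
    using assms by (simp add: poly_eq_0_iff_dvd[symmetric])
  then have "Q_poly P b * [:- b, 1:] = P - [:b:]"
    unfolding Q_poly_def by (rule dvd_div_mult_self)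
  from arg_cong[OF this, of "\<lambda>r. poly r x"] show ?thesis by (simp add: algebra_simps)
qed

lemma minus_const_nonzero:
  fixes P :: "'a::comm_ring_1 poly"
  assumes "degree P > 0"
  shows "P - [:w:] \<noteq> 0"
  using assms by auto

lemma poly_inverse_branch:
  assumes "inverse_branches P B" "i < degree P"
  shows "poly P (B i w) = w"
proof -
  have "B i w \<in># proots (P - [:w:])"
    using assms unfolding inverse_branches_def by (metis atLeastLessThan_iff image_eqI
        le0 list.set_map set_mset_mset set_upt)
  then show ?thesis
    using minus_const_nonzero[of P w] assms(2) by simp
qed

lemma card_inverse_branches:
  assumes "inverse_branches P B" "degree P > 0"
  shows "card {i. i < degree P \<and> B i w = v} = order v (P - [:w:])"
proof -
  have "count (proots (P - [:w:])) v = count (mset (map (\<lambda>i. B i w) [0..<degree P])) v"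
    using assms(1) unfolding inverse_branches_def by simp
  also have "\<dots> = length (filter (\<lambda>x. v = x) (map (\<lambda>i. B i w) [0..<degree P]))"
    by (simp only: count_mset count_list_eq_length_filter)
  also have "\<dots> = card {i. i < degree P \<and> B i w = v}"
    by (simp only: length_filter_conv_card) (rule arg_cong[of _ _ card], auto)
  finally show ?thesis
    using minus_const_nonzero[OF assms(2), of w] by simp
qed

text \<open>Differentiation lowers the order of a root by one, and here the derivative has order
  0.\<close>

lemma order_eq_1:
  fixes p :: "'a::field_char_0 poly"
  assumes "poly p x = 0" "poly (pderiv p) x \<noteq> 0"
  shows "order x p = 1"
proof -
  have "p \<noteq> 0" using assms(2) by auto
  then show ?thesis
    using order_pderiv[of p x] order_0I[OF assms(2)] assms(1) by simp
qed

section \<open>Counting sequences whose entries are eventually forced\<close>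

lemma card_eventually_singleton:
  fixes S :: "nat \<Rightarrow> nat set"
  assumes "\<And>n. n > N \<Longrightarrow> S n = {c}"
  shows "card (PiE {1..} S) = (\<Prod>n=1..N. card (S n))"
    and "(\<And>n. finite (S n)) \<Longrightarrow> finite (PiE {1..} S)"
proof -
  \<comment> \<open>The inverse of restriction to \<open>{1..N}\<close>: beyond \<open>N\<close> the
    only possible value is \<open>c\<close>, and at 0 extensionality over \<open>{1..}\<close>
    forces \<open>undefined\<close>.\<close>
  let ?g = "\<lambda>\<tau> n. if n \<in> {1..N} then \<tau> n else if n = 0 then undefined else c"
  have bij: "bij_betw (\<lambda>\<sigma>. restrict \<sigma> {1..N}) (PiE {1..} S) (PiE {1..N} S)"
  proof (rule bij_betw_byWitness[where f' = ?g])
    show "\<forall>\<sigma>\<in>PiE {1..} S. ?g (restrict \<sigma> {1..N}) = \<sigma>"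
    proof
      fix \<sigma> assume s: "\<sigma> \<in> PiE {1..} S"
      have "\<sigma> n = c" if "n > N" for n
        using PiE_mem[OF s, of n] assms[OF that] that by auto
      then show "?g (restrict \<sigma> {1..N}) = \<sigma>"
        using PiE_arb[OF s, of 0] by (auto simp: fun_eq_iff)
    qed
    show "\<forall>\<tau>\<in>PiE {1..N} S. restrict (?g \<tau>) {1..N} = \<tau>"
      by (auto simp: fun_eq_iff PiE_def extensional_def)
    show "(\<lambda>\<sigma>. restrict \<sigma> {1..N}) ` PiE {1..} S \<subseteq> PiE {1..N} S"
      by auto
    show "?g ` PiE {1..N} S \<subseteq> PiE {1..} S"
      using assms by (auto simp: PiE_def extensional_def Pi_def)
  qed
  show "card (PiE {1..} S) = (\<Prod>n=1..N. card (S n))"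
    using bij_betw_same_card[OF bij] by (simp add: card_PiE)
  show "finite (PiE {1..} S)" if "\<And>n. finite (S n)"
    using bij_betw_finite[OF bij] finite_PiE[of "{1..N}" S] that by simp
qed

lemma tendsto_zero_nat_iff:
  fixes \<sigma> :: "nat \<Rightarrow> nat"
  shows "\<sigma> \<longlonglongrightarrow> 0 \<longleftrightarrow> (\<exists>N. \<forall>n\<ge>N. \<sigma> n = 0)"
  by (simp add: tendsto_discrete eventually_sequentially)

locale poincare_function =
  fixes P :: "complex poly" and a b :: complex
    and f :: "complex \<Rightarrow> complex"
    and B :: "nat \<Rightarrow> complex \<Rightarrow> complex"
  assumes deg: "degree P \<ge> 2"
    and b_nz: "b \<noteq> 0"
    and b_fixed: "poly P b = b"
    and a_eq: "a = poly (pderiv P) b"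
    and repelling: "cmod a > 1"
    and f_entire: "f holomorphic_on UNIV"
    and f_eq: "\<And>z. f (a * z) = poly P (f z)"
    and f_0: "f 0 = b"
    and f'_0: "deriv f 0 = 1"
    and branches: "inverse_branches P B"
    and principal: "principal_branch b (B 0)"
    and hyp1: "\<And>w. (\<lambda>n. (B 0 ^^ n) w) \<longlonglongrightarrow> b"
begin

section \<open>Backward orbits of 0 and the telescoping product\<close>

lemma a_nz: "a \<noteq> 0"
  using repelling by auto

lemma P_f_divide: "poly P (f (z / a ^ Suc n)) = f (z / a ^ n)"
  using f_eq[of "z / a ^ Suc n"] a_nz by simp

lemma divide_power_tendsto: "(\<lambda>n. z / a ^ n) \<longlonglongrightarrow> 0"
proof -
  have "(\<lambda>n. z * (inverse a) ^ n) \<longlonglongrightarrow> z * 0"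
    using repelling by (intro tendsto_intros LIMSEQ_power_zero)
      (simp add: norm_inverse inverse_less_1_iff)
  then show ?thesis by (simp add: divide_inverse power_inverse)
qed

lemma isCont_f: "isCont f z"
  using holomorphic_on_imp_continuous_on[OF f_entire] by (simp add: continuous_on_eq_continuous_at)

lemma f_divide_tendsto: "(\<lambda>n. f (z / a ^ n)) \<longlonglongrightarrow> b"
  using isCont_tendsto_compose[OF isCont_f divide_power_tendsto] by (simp add: f_0)

lemma poly_branch_comp:
  assumes "\<And>n. n \<ge> 1 \<Longrightarrow> \<sigma> n < degree P"
  shows "poly P (branch_comp B \<sigma> (Suc n) 0) = branch_comp B \<sigma> n 0"
  using poly_inverse_branch[OF branches] assms by simp

text \<open>An orbit point equal to \<open>b\<close> would, under the fixed point equation, make its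
  predecessor \<open>b\<close> too, and so on back to the starting point 0.\<close>

lemma branch_comp_neq_b:
  assumes "\<And>n. n \<ge> 1 \<Longrightarrow> \<sigma> n < degree P"
  shows "branch_comp B \<sigma> n 0 \<noteq> b"
proof (induction n)
  case 0
  show ?case using b_nz by simp
next
  case (Suc n)
  then show ?case using poly_branch_comp[of \<sigma> n] assms b_fixed by metis
qed

lemma Q_branch_comp:
  assumes "\<And>n. n \<ge> 1 \<Longrightarrow> \<sigma> n < degree P"
  shows "poly (Q_poly P b) (branch_comp B \<sigma> (Suc n) 0) * (branch_comp B \<sigma> (Suc n) 0 - b)
           = branch_comp B \<sigma> n 0 - b"
  by (simp only: Q_poly_mult[OF b_fixed] poly_branch_comp[OF assms])

lemma Q_branch_comp_nonzero:
  assumes "\<And>n. n \<ge> 1 \<Longrightarrow> \<sigma> n < degree P" "n \<ge> 1"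
  shows "poly (Q_poly P b) (branch_comp B \<sigma> n 0) \<noteq> 0"
proof -
  obtain m where "n = Suc m" using assms(2) by (cases n) auto
  then show ?thesis
    using Q_branch_comp[of \<sigma> m] branch_comp_neq_b[of \<sigma> m] assms(1) by auto
qed

lemma partial_product_eq:
  assumes "\<And>n. n \<ge> 1 \<Longrightarrow> \<sigma> n < degree P"
  shows "- b * partial_product P b B \<sigma> N = a ^ N * (branch_comp B \<sigma> N 0 - b)"
proof (induction N)
  case 0
  show ?case by (simp add: partial_product_def)
next
  case (Suc N)
  let ?q = "poly (Q_poly P b) (branch_comp B \<sigma> (Suc N) 0)"
  have "- b * partial_product P b B \<sigma> (Suc N) = (- b * partial_product P b B \<sigma> N) * (a / ?q)"
    by (simp add: partial_product_def a_eq)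
  also have "\<dots> = a ^ N * (?q * (branch_comp B \<sigma> (Suc N) 0 - b)) * (a / ?q)"
    by (simp only: Suc.IH Q_branch_comp[OF assms])
  also have "\<dots> = a ^ Suc N * (branch_comp B \<sigma> (Suc N) 0 - b)"
    using Q_branch_comp_nonzero[of \<sigma> "Suc N"] assms by (simp del: branch_comp.simps)
  finally show ?case .
qed

text \<open>Since \<open>f(0) = b\<close>, the limit is \<open>z f'(0)\<close>.\<close>

lemma scaled_difference_tendsto: "(\<lambda>n. a ^ n * (f (z / a ^ n) - b)) \<longlonglongrightarrow> z"
proof (cases "z = 0")
  case True
  then show ?thesis by (simp add: f_0)
next
  case False
  have "(f has_field_derivative 1) (at 0)"
    using holomorphic_derivI[OF f_entire, of 0] f'_0 by simp
  then have "((\<lambda>h. (f h - b) / h) \<longlongrightarrow> 1) (at 0)"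
    by (simp add: DERIV_def f_0)
  moreover have "filterlim (\<lambda>n. z / a ^ n) (at 0) sequentially"
    using divide_power_tendsto False a_nz by (simp add: filterlim_at)
  ultimately have "(\<lambda>n. (f (z / a ^ n) - b) / (z / a ^ n)) \<longlonglongrightarrow> 1"
    by (rule filterlim_compose)
  then have "(\<lambda>n. z * ((f (z / a ^ n) - b) / (z / a ^ n))) \<longlonglongrightarrow> z * 1"
    by (intro tendsto_intros)
  then show ?thesis
    using False by (simp add: mult.commute)
qed

lemma product_of_lifted_orbit:
  assumes "\<And>n. n \<ge> 1 \<Longrightarrow> \<sigma> n < degree P"
    and "\<And>n. branch_comp B \<sigma> n 0 = f (z / a ^ n)"
  shows "convergent (partial_product P b B \<sigma>)" "z_of P b B \<sigma> = z"
proof -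
  have "partial_product P b B \<sigma> = (\<lambda>n. (a ^ n * (f (z / a ^ n) - b)) / (- b))"
    using partial_product_eq[OF assms(1)] b_nz
    by (auto simp: fun_eq_iff assms(2) field_simps)
  moreover have "(\<lambda>n. (a ^ n * (f (z / a ^ n) - b)) / (- b)) \<longlonglongrightarrow> z / (- b)"
    using b_nz by (intro tendsto_divide scaled_difference_tendsto tendsto_const) auto
  ultimately have lim: "partial_product P b B \<sigma> \<longlonglongrightarrow> z / (- b)" by simp
  then show "convergent (partial_product P b B \<sigma>)"
    by (rule convergentI)
  show "z_of P b B \<sigma> = z"
    unfolding z_of_def limI[OF lim] using b_nz by simp
qed

lemma branch_comp_tendsto:
  assumes "\<sigma> \<longlonglongrightarrow> 0"
  shows "(\<lambda>n. branch_comp B \<sigma> n 0) \<longlonglongrightarrow> b"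
proof -
  obtain N where N: "\<And>n. n \<ge> N \<Longrightarrow> \<sigma> n = 0"
    using assms unfolding tendsto_zero_nat_iff by blast
  \<comment> \<open>From index \<open>N\<close> on only the principal branch acts, so the tail is an
    iteration of \<open>B 0\<close> and \<open>hyp1\<close> applies.\<close>
  have "branch_comp B \<sigma> (n + N) 0 = (B 0 ^^ n) (branch_comp B \<sigma> N 0)" for n
    by (induction n) (simp_all add: N)
  then have "(\<lambda>n. branch_comp B \<sigma> (n + N) 0) \<longlonglongrightarrow> b"
    using hyp1 by simp
  then show ?thesis
    by (rule LIMSEQ_offset)
qed

section \<open>Lifting backward orbits through \<open>f\<close>\<close>

lemma orbit_lift:
  assumes less: "\<And>n. n \<ge> 1 \<Longrightarrow> \<sigma> n < degree P" and "\<sigma> \<longlonglongrightarrow> 0"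
  obtains z where "\<And>n. branch_comp B \<sigma> n 0 = f (z / a ^ n)"
proof -
  let ?w = "\<lambda>n. branch_comp B \<sigma> n 0"
  obtain r where r: "r > 0" "inj_on f (ball 0 r)"
    using has_complex_derivative_locally_injective[OF f_entire, of 0] f'_0 by auto
  \<comment> \<open>With this radius, multiplication by \<open>a\<close> maps
    \<open>ball 0 s\<close> into \<open>ball 0 r\<close>, where \<open>f\<close> is
    injective.\<close>
  define s where "s = r / cmod a"
  have s: "s > 0" "s \<le> r" "cmod a * s = r"
    using r repelling unfolding s_def by (auto simp: divide_le_eq intro!: divide_pos_pos)
  \<comment> \<open>The image is an open neighbourhood of \<open>b = f 0\<close>, so it eventually
    contains the orbit; \<open>y n\<close> will be the local preimage of the orbit point.\<close>
  have "open (f ` ball 0 s)"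
    by (intro open_mapping_thm3 holomorphic_on_subset[OF f_entire] inj_on_subset[OF r(2)])
      (use s subset_ball[OF s(2)] in auto)
  moreover have "b \<in> f ` ball 0 s"
    using s f_0 by (intro image_eqI[of _ _ 0]) auto
  ultimately have "eventually (\<lambda>n. ?w n \<in> f ` ball 0 s) sequentially"
    using branch_comp_tendsto[OF assms(2)] by (rule topological_tendstoD[rotated 1])
  then obtain M where "\<And>n. n \<ge> M \<Longrightarrow> ?w n \<in> f ` ball 0 s"
    unfolding eventually_sequentially by blast
  then have "\<forall>n. \<exists>y. n \<ge> M \<longrightarrow> y \<in> ball 0 s \<and> f y = ?w n"
    by (metis imageE)
  then obtain y where y: "\<And>n. n \<ge> M \<Longrightarrow> y n \<in> ball 0 s" "\<And>n. n \<ge> M \<Longrightarrow> f (y n) = ?w n"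
    by metis
  \<comment> \<open>Both sides have the same image:
    \<open>f (a * y (Suc n)) = P (f (y (Suc n)))\<close>, and \<open>P\<close> undoes the branch
    applied last.\<close>
  have step: "a * y (Suc n) = y n" if "n \<ge> M" for n
  proof (rule inj_onD[OF r(2)])
    show "f (a * y (Suc n)) = f (y n)"
      using that y(2)[of n] y(2)[of "Suc n"] poly_branch_comp[of \<sigma> n] less
      by (simp add: f_eq del: branch_comp.simps)
    show "y n \<in> ball 0 r" using y(1)[OF that] s by auto
    have "cmod a * cmod (y (Suc n)) < cmod a * s"
      using y(1)[of "Suc n"] that repelling by (intro mult_strict_left_mono) auto
    then show "a * y (Suc n) \<in> ball 0 r" using s by (simp add: norm_mult)
  qed
  define z where "z = a ^ M * y M"
  have "y (M + k) = z / a ^ (M + k)" for k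
  proof (induction k)
    case 0
    show ?case using a_nz by (simp add: z_def)
  next
    case (Suc k)
    then have "a * y (Suc (M + k)) = z / a ^ (M + k)"
      using step[of "M + k"] by simp
    then show ?case using a_nz by (simp add: field_simps)
  qed
  then have large: "?w n = f (z / a ^ n)" if "n \<ge> M" for n
    using y(2)[OF that] that by (metis le_add_diff_inverse)
  have "?w (M - k) = f (z / a ^ (M - k))" for k
  proof (induction k)
    case 0
    show ?case using large[of M] by simp
  next
    case (Suc k)
    show ?case
    proof (cases "k < M")
      case True
      then have "M - k = Suc (M - Suc k)" by simp
      with Suc have "?w (Suc (M - Suc k)) = f (z / a ^ Suc (M - Suc k))"
        by (simp only:)
      then show ?thesis
        using poly_branch_comp[of \<sigma> "M - Suc k"] less P_f_divide[of z "M - Suc k"]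
        by (simp only:)
    next
      case False
      with Suc show ?thesis by simp
    qed
  qed
  then have "?w n = f (z / a ^ n)" if "n \<le> M" for n
    using that by (metis diff_diff_cancel)
  with large have "?w n = f (z / a ^ n)" for n
    using linear by blast
  then show ?thesis by (rule that)
qed

section \<open>Admissible indices and the fibres of \<open>z_of\<close>\<close>

text \<open>The set \<open>S\<^sub>n\<close> of the overview. Index \<open>n\<close> governs the
  step from \<open>z / a^(n - 1)\<close> to \<open>z / a^n\<close>, hence the shift to
  \<open>Suc n\<close> in the cardinality results.\<close>

definition admissible :: "complex \<Rightarrow> nat \<Rightarrow> nat set" where
  "admissible z n = {i. i < degree P \<and> B i (f (z / a ^ (n - 1))) = f (z / a ^ n)}"

lemma finite_admissible: "finite (admissible z n)"
  by (simp add: admissible_def)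

lemma card_admissible:
  "card (admissible z (Suc n)) = order (f (z / a ^ Suc n)) (P - [:f (z / a ^ n):])"
  unfolding admissible_def using card_inverse_branches[OF branches] deg by simp

lemma admissible_nonempty: "admissible z (Suc n) \<noteq> {}"
proof -
  have "order (f (z / a ^ Suc n)) (P - [:f (z / a ^ n):]) \<noteq> 0"
    using P_f_divide[of z n] minus_const_nonzero[of P "f (z / a ^ n)"] deg
      order_root[of "P - [:f (z / a ^ n):]" "f (z / a ^ Suc n)"] by simp
  then show ?thesis
    using card_admissible[of z n] by auto
qed

lemma isCont_principal: "isCont (B 0) b"
  using principal analytic_on_imp_differentiable_at field_differentiable_imp_continuous_at
  unfolding principal_branch_def by blast

text \<open>\<open>P\<close> is injective near \<open>b\<close> because \<open>P'(b) = a\<close> is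
  nonzero. For large \<open>n\<close> both \<open>B 0 (f (z / a^n))\<close> and
  \<open>f (z / a^(n+1))\<close> are preimages of \<open>f (z / a^n)\<close> close to
  \<open>b\<close>, so they agree and 0 is admissible. The root is simple since \<open>P'\<close>
  does not vanish there, so no other index is.\<close>

lemma eventually_admissible: "\<exists>N. \<forall>n>N. admissible z n = {0}"
proof -
  let ?u = "\<lambda>n. f (z / a ^ n)"
  have "deriv (poly P) b \<noteq> 0"
    using a_nz a_eq by (simp add: DERIV_imp_deriv[OF poly_DERIV])
  then obtain r where r: "r > 0" "inj_on (poly P) (ball b r)"
    using has_complex_derivative_locally_injective[of "poly P" UNIV b]
      poly_holomorphic_on[OF holomorphic_on_ident, of P UNIV] by auto
  have "(\<lambda>n. B 0 (?u n)) \<longlonglongrightarrow> B 0 b"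
    by (rule isCont_tendsto_compose[OF isCont_principal f_divide_tendsto])
  then have lim_B: "(\<lambda>n. B 0 (?u n)) \<longlonglongrightarrow> b"
    using principal unfolding principal_branch_def by simp
  have lim_u: "(\<lambda>n. ?u (Suc n)) \<longlonglongrightarrow> b"
    using f_divide_tendsto by (rule LIMSEQ_Suc)
  have ball: "open (ball b r)" "b \<in> ball b r" using r by auto
  have "eventually (\<lambda>n. B 0 (?u n) = ?u (Suc n)) sequentially"
    using topological_tendstoD[OF lim_B ball] topological_tendstoD[OF lim_u ball]
  proof eventually_elim
    case (elim n)
    have "poly P (B 0 (?u n)) = poly P (?u (Suc n))"
      using poly_inverse_branch[OF branches, of 0] deg P_f_divide[of z n] by simp
    then show ?case using elim by (rule inj_onD[OF r(2)])
  qed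
  moreover have "(\<lambda>n. poly (pderiv P) (?u (Suc n))) \<longlonglongrightarrow> a"
    using isCont_tendsto_compose[OF poly_isCont lim_u, of "pderiv P"] by (simp add: a_eq)
  then have "eventually (\<lambda>n. poly (pderiv P) (?u (Suc n)) \<noteq> 0) sequentially"
    using a_nz by (rule tendsto_imp_eventually_ne)
  ultimately have "eventually (\<lambda>n. admissible z (Suc n) = {0}) sequentially"
  proof eventually_elim
    case (elim n)
    have "card (admissible z (Suc n)) = 1"
      unfolding card_admissible
      by (rule order_eq_1) (use elim P_f_divide[of z n] in \<open>simp_all add: pderiv_diff pderiv_pCons\<close>)
    moreover have "0 \<in> admissible z (Suc n)"
      using elim deg by (simp add: admissible_def)
    ultimately show ?case
      by (metis card_1_singletonE singletonD)
  qed
  then obtain N where N: "\<And>n. n \<ge> N \<Longrightarrow> admissible z (Suc n) = {0}"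
    unfolding eventually_sequentially by blast
  have "admissible z n = {0}" if "n > N" for n
    using N[of "n - 1"] that by simp
  then show ?thesis by blast
qed

lemma branch_comp_admissible:
  assumes "f z = 0" "\<And>n. n \<ge> 1 \<Longrightarrow> \<sigma> n \<in> admissible z n"
  shows "branch_comp B \<sigma> n 0 = f (z / a ^ n)"
proof (induction n)
  case 0
  show ?case using assms(1) by simp
next
  case (Suc n)
  then show ?case using assms(2)[of "Suc n"] by (simp add: admissible_def)
qed

lemma Sigma_seqsD:
  assumes "\<sigma> \<in> Sigma_seqs (degree P)"
  shows "\<And>n. n \<ge> 1 \<Longrightarrow> \<sigma> n < degree P" "\<sigma> \<longlonglongrightarrow> 0"
  using assms unfolding Sigma_seqs_def by auto

lemma fiber_eq:
  assumes "f z = 0"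
  shows "{\<sigma> \<in> Sigma_seqs (degree P). z_of P b B \<sigma> = z} = PiE {1..} (admissible z)"
proof (intro equalityI subsetI)
  fix \<sigma> assume s: "\<sigma> \<in> {\<sigma> \<in> Sigma_seqs (degree P). z_of P b B \<sigma> = z}"
  then have less: "\<And>n. n \<ge> 1 \<Longrightarrow> \<sigma> n < degree P" and lim: "\<sigma> \<longlonglongrightarrow> 0"
    using Sigma_seqsD by auto
  obtain y where y: "\<And>n. branch_comp B \<sigma> n 0 = f (y / a ^ n)"
    using orbit_lift[OF less lim] by blast
  \<comment> \<open>The lift at \<open>y\<close> gives \<open>z_of P b B \<sigma> = y\<close>, while
    membership in the fibre says it is \<open>z\<close>.\<close>
  with s have "y = z"
    using product_of_lifted_orbit(2)[OF less y] by simp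
  have "\<sigma> (Suc n) \<in> admissible z (Suc n)" for n
    using y[of n] y[of "Suc n"] less[of "Suc n"] \<open>y = z\<close> by (simp add: admissible_def)
  then have "\<sigma> n \<in> admissible z n" if "n \<ge> 1" for n
    using that by (cases n) auto
  then show "\<sigma> \<in> PiE {1..} (admissible z)"
    using s by (auto simp: Sigma_seqs_def PiE_iff)
next
  fix \<sigma> assume s: "\<sigma> \<in> PiE {1..} (admissible z)"
  then have adm: "\<sigma> n \<in> admissible z n" if "n \<ge> 1" for n
    using that by auto
  then have less: "\<sigma> n < degree P" if "n \<ge> 1" for n
    using that by (auto simp: admissible_def)
  obtain N where "\<forall>n>N. admissible z n = {0}"
    using eventually_admissible by blast
  \<comment> \<open>The eventual singletons \<open>{0}\<close> are what place
    \<open>\<sigma>\<close> in \<open>Sigma_seqs\<close>.\<close>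
  then have "\<sigma> n = 0" if "n \<ge> Suc N" for n
    using adm[of n] that by auto
  then have "\<sigma> \<longlonglongrightarrow> 0"
    unfolding tendsto_zero_nat_iff by blast
  then show "\<sigma> \<in> {\<sigma> \<in> Sigma_seqs (degree P). z_of P b B \<sigma> = z}"
    using s less product_of_lifted_orbit(2)[OF less branch_comp_admissible[OF assms adm]]
    by (auto simp: Sigma_seqs_def PiE_iff)
qed

section \<open>Multiplicities along the chain \<open>f(z) = P(f(z / a))\<close>\<close>

lemma has_multiplicity_step:
  assumes "has_multiplicity f (z / a ^ Suc n) m"
  shows "has_multiplicity f (z / a ^ n) (card (admissible z (Suc n)) * m)"
proof -
  have f_divide: "poly P (f (x / a)) = f x" for x
    using f_eq[of "x / a"] a_nz by simp
  have "has_multiplicity (\<lambda>x. poly P (f x)) (z / a ^ Suc n)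
      (order (f (z / a ^ Suc n)) (P - [:poly P (f (z / a ^ Suc n)):]) * m)"
    using deg by (intro has_multiplicity_poly[OF assms f_entire] minus_const_nonzero) simp
  then have "has_multiplicity (\<lambda>x. poly P (f x)) ((z / a ^ n) / a)
      (card (admissible z (Suc n)) * m)"
    by (simp only: card_admissible P_f_divide) (simp add: mult.commute)
  from has_multiplicity_divide[OF this a_nz] show ?thesis
    by (simp only: f_divide)
qed

text \<open>The induction peels off the step nearest to \<open>z / a^N\<close>; \<open>m\<close>
  varies because it absorbs the factor of each step passed.\<close>

lemma has_multiplicity_prod:
  assumes "has_multiplicity f (z / a ^ N) m"
  shows "has_multiplicity f z ((\<Prod>n=1..N. card (admissible z n)) * m)"
  using assms
proof (induction N arbitrary: m)
  case 0
  then show ?case by simp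
next
  case (Suc N)
  from Suc.IH[OF has_multiplicity_step[OF Suc.prems]] show ?case
    by (simp add: mult.assoc)
qed

text \<open>The derivative of \<open>f\<close> at \<open>z / a^n\<close> tends to
  \<open>f'(0) = 1\<close>, hence is eventually nonzero.\<close>

lemma eventually_has_multiplicity_1: "\<exists>N. \<forall>n\<ge>N. has_multiplicity f (z / a ^ n) 1"
proof -
  have "isCont (deriv f) 0"
    using holomorphic_on_imp_continuous_on[OF holomorphic_deriv[OF f_entire]]
    by (simp add: continuous_on_eq_continuous_at)
  then have "(\<lambda>n. deriv f (z / a ^ n)) \<longlonglongrightarrow> 1"
    using isCont_tendsto_compose[OF _ divide_power_tendsto] f'_0 by fastforce
  then have "eventually (\<lambda>n. deriv f (z / a ^ n) \<noteq> 0) sequentially"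
    by (rule tendsto_imp_eventually_ne) simp
  then show ?thesis
    unfolding eventually_sequentially using has_multiplicity_1[OF f_entire] by blast
qed

lemma finite_fiber_and_zorder:
  assumes "f z = 0"
  shows "finite (PiE {1..} (admissible z))"
    and "zorder f z = int (card (PiE {1..} (admissible z)))"
proof -
  obtain N1 where N1: "\<forall>n>N1. admissible z n = {0}"
    using eventually_admissible by blast
  obtain N2 where N2: "\<forall>n\<ge>N2. has_multiplicity f (z / a ^ n) 1"
    using eventually_has_multiplicity_1 by blast
  \<comment> \<open>At this \<open>N\<close> the chain starts with multiplicity 1, and all later
    admissible sets are \<open>{0}\<close>, so the product of the first \<open>N\<close>
    cardinalities is both the multiplicity and the number of sequences.\<close>
  define N where "N = max N1 N2"
  have N: "admissible z n = {0}" if "n > N" for n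
    using N1 that unfolding N_def by simp
  show "finite (PiE {1..} (admissible z))"
    using card_eventually_singleton(2)[OF N] finite_admissible by simp
  have "has_multiplicity f (z / a ^ N) 1"
    using N2 unfolding N_def by simp
  from has_multiplicity_prod[OF this] show "zorder f z = int (card (PiE {1..} (admissible z)))"
    using zorder_has_multiplicity assms card_eventually_singleton(1)[OF N] by simp
qed

section \<open>The zero set and convergence of the products\<close>

lemma zero_set_eq: "{z. f z = 0} = z_of P b B ` Sigma_seqs (degree P)"
proof (intro equalityI subsetI)
  fix z assume "z \<in> {z. f z = 0}"
  then have z: "f z = 0" by simp
  have "admissible z n \<noteq> {}" if "n \<ge> 1" for n
    using that admissible_nonempty[of z "n - 1"] by simp
  then have "PiE {1..} (admissible z) \<noteq> {}"
    by (simp add: PiE_eq_empty_iff)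
  then show "z \<in> z_of P b B ` Sigma_seqs (degree P)"
    unfolding fiber_eq[OF z, symmetric] by blast
next
  fix z assume "z \<in> z_of P b B ` Sigma_seqs (degree P)"
  then obtain \<sigma> where s: "\<sigma> \<in> Sigma_seqs (degree P)" "z = z_of P b B \<sigma>" by blast
  obtain y where y: "\<And>n. branch_comp B \<sigma> n 0 = f (y / a ^ n)"
    using orbit_lift[OF Sigma_seqsD[OF s(1)]] by blast
  have "z = y"
    using s product_of_lifted_orbit(2)[OF Sigma_seqsD(1)[OF s(1)] y] by simp
  \<comment> \<open>At index 0 the lifted orbit reads \<open>0 = f y\<close>.\<close>
  with y[of 0] show "z \<in> {z. f z = 0}" by simp
qed

text \<open>Division and \<open>lim\<close> are total functions, so these two facts certify that
  \<open>z_of\<close> is a genuine infinite product.\<close>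

lemma product_well_defined:
  assumes "\<sigma> \<in> Sigma_seqs (degree P)"
  shows "(\<forall>n\<ge>1. poly (Q_poly P b) (branch_comp B \<sigma> n 0) \<noteq> 0) \<and>
         convergent (partial_product P b B \<sigma>)"
proof -
  obtain y where y: "\<And>n. branch_comp B \<sigma> n 0 = f (y / a ^ n)"
    using orbit_lift[OF Sigma_seqsD[OF assms]] by blast
  then show ?thesis
    using Q_branch_comp_nonzero product_of_lifted_orbit(1) Sigma_seqsD(1)[OF assms] by blast
qed

end

theorem theorem1p1:
  fixes P :: "complex poly" and a b :: complex
    and f :: "complex \<Rightarrow> complex"
    and B :: "nat \<Rightarrow> complex \<Rightarrow> complex"
  assumes deg: "degree P \<ge> 2"
    and b_nz: "b \<noteq> 0"
    and b_fixed: "poly P b = b"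
    and a_eq: "a = poly (pderiv P) b"
    and repelling: "cmod a > 1"
    and f_entire: "f holomorphic_on UNIV"
    and f_eq: "\<And>z. f (a * z) = poly P (f z)"
    and f_0: "f 0 = b"
    and f'_0: "deriv f 0 = 1"
    and branches: "inverse_branches P B"
    and principal: "principal_branch b (B 0)"
    and hyp1: "\<And>w. (\<lambda>n. (B 0 ^^ n) w) \<longlonglongrightarrow> b"
  shows "(\<forall>\<sigma>\<in>Sigma_seqs (degree P).
            (\<forall>n\<ge>1. poly (Q_poly P b) (branch_comp B \<sigma> n 0) \<noteq> 0) \<and>
            convergent (partial_product P b B \<sigma>)) \<and>
         {z. f z = 0} = z_of P b B ` Sigma_seqs (degree P) \<and>
         (\<forall>z0. f z0 = 0 \<longrightarrow>
            finite {\<sigma> \<in> Sigma_seqs (degree P). z_of P b B \<sigma> = z0} \<and>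
            zorder f z0 = int (card {\<sigma> \<in> Sigma_seqs (degree P). z_of P b B \<sigma> = z0}))"
proof -
  interpret poincare_function P a b f B
    by unfold_locales fact+
  show ?thesis
    using product_well_defined zero_set_eq finite_fiber_and_zorder
    by (simp add: fiber_eq)
qed

end
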